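(* Suppose that $$k<\frac{1}{(2C_{\mathsf A}+L)\,C_P},$$ and that $\mathsf{F}:[0,T]\times\mathbb{R}^d\to\mathbb{R}^d$ is Lipschitz continuous in the second variable with Lipschitz constant $L$, i.e. $\|\mathsf{F}(t,v)-\mathsf{F}(t,w)\|\le L\|v-w\|$ for all $v,w\in\mathbb{R}^d$ and $t\in[0,T]$. Then, for given $u_0\in\mathbb{R}^d$, the continuous Galerkin method admits a unique solution, i.e. there exists exactly one $\mathcal{U}\in\mathcal{S}^{\mathbf r,1}(\tau_N;\mathbb{R}^d)$ such that $\mathcal{U}(0)=u_0$ and $$\sum_{n=1}^N\int_{I_n}(\dot{\mathcal{U}}(t),\varphi(t))\,dt=\sum_{n=1}^N\int_{I_n}(\mathsf{F}(t,\mathcal{U}(t)),\varphi(t))\,dt\qquad\forall\varphi\in\mathcal{S}^{\mathbf r-1,0}(\tau_N;\mathbb{R}^d).$$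
   Context: Let $d\ge 1$, $T\in(0,\infty)$, $I=[0,T]$, and let $0=t_0<t_1<\dots<t_N=T$ be a partition $\tau_N=\{I_n\}_{n=1}^N$ of $I$ into open subintervals $I_n=(t_{n-1},t_n)$, with local time steps $k_n=t_n-t_{n-1}$ and $k=\max_{1\le n\le N}k_n$. Let $\mathbf r=(r_n)_{n=1}^N$ with $r_n\in\mathbb{N}_{\ge 0}$ be the local polynomial degrees. $(\cdot,\cdot)$ is the Euclidean inner product on $\mathbb{R}^d$ with norm $\|\cdot\|$. For an interval $J$ and an integer $r\ge 0$, $\mathcal{P}^r(J;\mathbb{R}^d)$ is the space of polynomials $p(t)=\sum_{j=0}^r a_jt^j$ on $J$ with $a_j\in\mathbb{R}^d$, and $\mathcal{P}^{-1}(J;\mathbb{R}^d)=\{0\}$. Define $$\mathcal{S}^{\mathbf r,1}(\tau_N;\mathbb{R}^d)=\{x\in H^1(I;\mathbb{R}^d): x|_{I_n}\in\mathcal{P}^{r_n}(I_n;\mathbb{R}^d),\ 1\le n\le N\},$$ $$\mathcal{S}^{\mathbf r-1,0}(\tau_N;\mathbb{R}^d)=\{x\in L^2(I;\mathbb{R}^d): x|_{I_n}\in\mathcal{P}^{r_n-1}(I_n;\mathbb{R}^d),\ 1\le n\le N\}.$$ (Elements of $\mathcal{S}^{\mathbf r,1}$ are continuous piecewise polynomials.) $\mathsf{A}:[0,T]\times\mathbb{R}^d\to\mathbb{R}^{d\times d}$ is a given map for which there is a constant $C_{\mathsf A}\ge 0$ with $\sup_{t\in[0,T]}\|\mathsf{A}(t,v)x\|\le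 C_{\mathsf A}\|x\|$ for all $v,x\in\mathbb{R}^d$ (the same constant for all $v$). It is implicit that $t\mapsto\mathsf{F}(t,v(t))$ is integrable and $t\mapsto\mathsf{A}(t,v(t))$ is measurable for (piecewise) polynomial $v$, so that all integrals are defined. $C_P>0$ is a fixed constant (Poincaré constant) such that for every bounded interval $(a,b)$ and every $w\in H^1((a,b);\mathbb{R}^d)$ with $w(a)=0$ one has $\|w\|_{L^2((a,b);\mathbb{R}^d)}\le (b-a)\,C_P\,\|\dot w\|_{L^2((a,b);\mathbb{R}^d)}$; $C_P$ does not depend on $(a,b)$ or $w$. Convention: $1/0=+\infty$. *)

theory Defs
  imports "HOL-Analysis.Analysis"
begin

text \<open>Elements of Lebesgue and Sobolev spaces are represented by actual functions on the real
  line, of which only the values on the interval at hand matter.\<close>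

definition L2_space :: "real set \<Rightarrow> (real \<Rightarrow> 'a::euclidean_space) set" where
  "L2_space J = {x. set_borel_measurable lebesgue J x \<and>
                    set_integrable lebesgue J (\<lambda>t. (norm (x t))\<^sup>2)}"

definition L2_norm :: "real set \<Rightarrow> (real \<Rightarrow> 'a::euclidean_space) \<Rightarrow> real" where
  "L2_norm J x = sqrt (LINT t:J|lebesgue. (norm (x t))\<^sup>2)"

definition test_functions :: "real set \<Rightarrow> (real \<Rightarrow> real) set" where
  "test_functions J = {\<psi>. (\<forall>m x. (deriv ^^ m) \<psi> field_differentiable at x) \<and>
                          compact (closure {x. \<psi> x \<noteq> 0}) \<and> closure {x. \<psi> x \<noteq> 0} \<subseteq> J}"

definition is_weak_deriv ::
    "real set \<Rightarrow> (real \<Rightarrow> 'a::euclidean_space) \<Rightarrow> (real \<Rightarrow> 'a) \<Rightarrow> bool" where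
  "is_weak_deriv J x g \<longleftrightarrow>
     (\<forall>\<psi>\<in>test_functions J.
        (LINT t:J|lebesgue. deriv \<psi> t *\<^sub>R x t) = - (LINT t:J|lebesgue. \<psi> t *\<^sub>R g t))"

text \<open>To be used with \<open>J\<close> a bounded open interval.  Every class in the Sobolev space then has
  exactly one representative that is continuous up to the boundary; this representative gives
  the point values (such as \<open>w(a) = 0\<close>), and it is the one taken here.\<close>

definition H1_space :: "real set \<Rightarrow> (real \<Rightarrow> 'a::euclidean_space) set" where
  "H1_space J = {x. x \<in> L2_space J \<and> (\<exists>g\<in>L2_space J. is_weak_deriv J x g) \<and>
                    continuous_on (closure J) x}"

text \<open>\<open>p \<in> poly_space q J\<close> says that the restriction of \<open>p\<close> to \<open>J\<close> is a polynomial of degree at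
  most \<open>q\<close> with vector coefficients.  The degree is an integer: for \<open>q = -1\<close> the sum is empty
  and \<open>p\<close> vanishes on \<open>J\<close>.\<close>

definition poly_space :: "int \<Rightarrow> real set \<Rightarrow> (real \<Rightarrow> 'a::euclidean_space) set" where
  "poly_space q J = {p. \<exists>a :: nat \<Rightarrow> 'a. \<forall>t\<in>J. p t = (\<Sum>j<nat (q + 1). t ^ j *\<^sub>R a j)}"

definition subint :: "(nat \<Rightarrow> real) \<Rightarrow> nat \<Rightarrow> real set" where
  "subint \<tau> n = {\<tau> (n - 1) <..< \<tau> n}"

definition max_step :: "nat \<Rightarrow> (nat \<Rightarrow> real) \<Rightarrow> real" where
  "max_step N \<tau> = Max ((\<lambda>n. \<tau> n - \<tau> (n - 1)) ` {1..N})"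

text \<open>Piecewise polynomials of arbitrary degrees; the values at the nodes are unrestricted.\<close>

definition piecewise_poly :: "nat \<Rightarrow> (nat \<Rightarrow> real) \<Rightarrow> (real \<Rightarrow> 'a::euclidean_space) set" where
  "piecewise_poly N \<tau> = {v. \<forall>n\<in>{1..N}. \<exists>q. v \<in> poly_space q (subint \<tau> n)}"

text \<open>Trial functions are functions on the closed interval \<open>[\<tau> 0, \<tau> N]\<close>: they take the value
  \<open>undefined\<close> outside, so that equality of trial functions is equality on that interval.\<close>

definition trial_space ::
    "nat \<Rightarrow> (nat \<Rightarrow> real) \<Rightarrow> (nat \<Rightarrow> nat) \<Rightarrow> (real \<Rightarrow> 'a::euclidean_space) set" where
  "trial_space N \<tau> r = {x \<in> H1_space {\<tau> 0<..<\<tau> N} \<inter> extensional {\<tau> 0..\<tau> N}.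
                          \<forall>n\<in>{1..N}. x \<in> poly_space (int (r n)) (subint \<tau> n)}"

definition test_space ::
    "nat \<Rightarrow> (nat \<Rightarrow> real) \<Rightarrow> (nat \<Rightarrow> nat) \<Rightarrow> (real \<Rightarrow> 'a::euclidean_space) set" where
  "test_space N \<tau> r = {x \<in> L2_space {\<tau> 0<..<\<tau> N}.
                         \<forall>n\<in>{1..N}. x \<in> poly_space (int (r n) - 1) (subint \<tau> n)}"

end

theory Submission imports Defs begin

text \<open>
  Test functions may be discontinuous at the nodes, hence the method is a time stepping scheme: it
  is equivalent to one problem for every subinterval, with initial value the terminal value from the
  previous subinterval (\<open>galerkin_iff_local\<close>).  So it suffices to solve a single step uniquely.

  Let \<open>u\<close> be a polynomial of degree at most \<open>n\<close> on an interval \<open>(a, b)\<close> with prescribed \<open>u a\<close>.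
  It is determined by its derivative, an arbitrary polynomial of degree at most \<open>n - 1\<close>, and the local
  equation says that this derivative is the \<open>L\<^sup>2\<close> projection of \<open>t \<mapsto> F t (u t)\<close> onto polynomials of
  degree at most \<open>n - 1\<close>.  This is a fixed point problem for the derivative.  If two candidates \<open>u\<close> and
  \<open>v\<close> have the same initial value, then the Lipschitz condition, the Cauchy--Schwarz inequality and the
  Poincare inequality give
  \<open>\<integral> (F t (u t) - F t (v t)) \<bullet> \<phi> \<le> L (b - a) CP \<parallel>u' - v'\<parallel> \<parallel>\<phi>\<parallel>\<close>
  (\<open>load_difference_estimate\<close>), and the bound on the steps makes \<open>L (b - a) CP < 1\<close>.  Existence
  follows from Banach's fixed point theorem (\<open>galerkin_exists\<close>), uniqueness by taking \<open>\<phi> = u' - v'\<close>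
  (\<open>galerkin_unique\<close>).

  The loads \<open>t \<mapsto> F t (u t)\<close> are only known to be integrable, not square integrable.  Their projection is
  still defined by the moments against an orthonormal basis of polynomials, and the estimate above
  involves the loads only through differences, which the Lipschitz condition controls pointwise.

  It remains to pass between polynomial pieces and the Sobolev space.  A continuous, piecewise
  polynomial function has its piecewise derivative as weak derivative (\<open>is_weak_deriv_piecewise\<close>).
  This puts the glued solution into the trial space, and it makes the Poincare inequality applicable to
  polynomials on one subinterval.
\<close>

section \<open>Vector polynomials\<close>

lemma poly_spaceI:
  "(\<And>t. t \<in> J \<Longrightarrow> v t = (\<Sum>j<nat (q + 1). t ^ j *\<^sub>R a j)) \<Longrightarrow> v \<in> poly_space q J"
  unfolding poly_space_def by blast

lemma poly_space_iff:
  "v \<in> poly_space (int n - 1) J \<longleftrightarrow> (\<exists>a. \<forall>t\<in>J. v t = (\<Sum>j<n. t ^ j *\<^sub>R a j))"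
  by (simp add: poly_space_def)

lemma poly_space_subset: "v \<in> poly_space q J \<Longrightarrow> K \<subseteq> J \<Longrightarrow> v \<in> poly_space q K"
  unfolding poly_space_def by blast

lemma poly_space_mono:
  assumes "v \<in> poly_space p J" "p \<le> q"
  shows "v \<in> poly_space q J"
proof -
  obtain a where a: "\<forall>t\<in>J. v t = (\<Sum>j<nat (p + 1). t ^ j *\<^sub>R a j)"
    using assms unfolding poly_space_def by blast
  have "(\<Sum>j<nat (p + 1). t ^ j *\<^sub>R a j) =
        (\<Sum>j<nat (q + 1). t ^ j *\<^sub>R (if j < nat (p + 1) then a j else 0))" for t :: real
    by (rule sum.mono_neutral_cong_left) (use assms(2) in \<open>auto simp: nat_less_iff\<close>)
  then show ?thesis
    using a by (intro poly_spaceI) simp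
qed

lemma poly_space_add:
  assumes "v \<in> poly_space q J" "w \<in> poly_space q J"
  shows "(\<lambda>t. v t + w t) \<in> poly_space q J"
proof -
  obtain a b where "\<forall>t\<in>J. v t = (\<Sum>j<nat (q + 1). t ^ j *\<^sub>R a j)"
    and "\<forall>t\<in>J. w t = (\<Sum>j<nat (q + 1). t ^ j *\<^sub>R b j)"
    using assms unfolding poly_space_def by blast
  then show ?thesis
    by (intro poly_spaceI[where a = "\<lambda>j. a j + b j"]) (simp add: sum.distrib scaleR_add_right)
qed

lemma poly_space_bounded_linear:
  assumes "v \<in> poly_space q J" "bounded_linear h"
  shows "(\<lambda>t. h (v t)) \<in> poly_space q J"
proof -
  interpret bounded_linear h by fact
  obtain a where "\<forall>t\<in>J. v t = (\<Sum>j<nat (q + 1). t ^ j *\<^sub>R a j)"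
    using assms unfolding poly_space_def by blast
  then show ?thesis
    by (intro poly_spaceI[where a = "\<lambda>j. h (a j)"]) (simp add: sum scale)
qed

lemma poly_space_diff:
  assumes "v \<in> poly_space q J" "w \<in> poly_space q J"
  shows "(\<lambda>t. v t - w t) \<in> poly_space q J"
  using poly_space_add[OF assms(1) poly_space_bounded_linear[OF assms(2)], of uminus]
  by (simp add: bounded_linear_minus[OF bounded_linear_ident])

lemma poly_space_sum:
  assumes "\<And>i. i \<in> S \<Longrightarrow> v i \<in> poly_space q J"
  shows "(\<lambda>t. \<Sum>i\<in>S. v i t) \<in> poly_space q J"
  using assms
proof (induction S rule: infinite_finite_induct)
  case (insert i S)
  then show ?case
    using poly_space_add[of "v i" q J] by simp
qed (auto simp: poly_space_def intro!: exI[where x = "\<lambda>_. 0"])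

lemma poly_space_monomial:
  assumes "j < n"
  shows "(\<lambda>t. t ^ j *\<^sub>R x) \<in> poly_space (int n - 1) J"
proof -
  have "(\<Sum>i<n. t ^ i *\<^sub>R (if i = j then x else 0)) = t ^ j *\<^sub>R x" for t :: real
    using assms by (simp add: if_distrib cong: if_cong)
  then show ?thesis
    by (intro poly_spaceI[where a = "\<lambda>i. if i = j then x else 0"]) simp
qed

lemma continuous_on_poly_space: "v \<in> poly_space q UNIV \<Longrightarrow> continuous_on S v"
proof -
  assume "v \<in> poly_space q UNIV"
  then obtain a where "v = (\<lambda>t. \<Sum>j<nat (q + 1). t ^ j *\<^sub>R a j)"
    unfolding poly_space_def by auto
  then show ?thesis
    by (auto intro!: continuous_intros)
qed

lemma poly_space_extension:
  assumes "v \<in> poly_space q J"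
  shows "\<exists>p\<in>poly_space q UNIV. \<forall>t\<in>J. v t = p t"
proof -
  obtain a where "\<forall>t\<in>J. v t = (\<Sum>j<nat (q + 1). t ^ j *\<^sub>R a j)"
    using assms unfolding poly_space_def by blast
  then show ?thesis
    by (intro bexI[where x = "\<lambda>t. \<Sum>j<nat (q + 1). t ^ j *\<^sub>R a j"])
      (auto simp: poly_space_def)
qed

lemma poly_space_derivative:
  assumes "v \<in> poly_space (int n) UNIV"
  shows "\<exists>v'\<in>poly_space (int n - 1) UNIV. \<forall>t. (v has_vector_derivative v' t) (at t)"
proof -
  obtain a where a: "v = (\<lambda>t. \<Sum>j<Suc n. t ^ j *\<^sub>R a j)"
    using assms unfolding poly_space_def by (auto simp: nat_add_distrib)
  define v' where "v' t = (\<Sum>j<n. t ^ j *\<^sub>R (real (Suc j) *\<^sub>R a (Suc j)))" for t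
  have "(v has_vector_derivative v' t) (at t)" for t
    unfolding a v'_def sum.lessThan_Suc_shift has_real_derivative_iff_has_vector_derivative[symmetric]
    by (rule derivative_eq_intros refl | simp add: algebra_simps)+
  moreover have "v' \<in> poly_space (int n - 1) UNIV"
    unfolding v'_def
    by (rule poly_spaceI[where a = "\<lambda>j. real (Suc j) *\<^sub>R a (Suc j)"]) simp
  ultimately show ?thesis by blast
qed

lemma poly_space_primitive:
  assumes "v \<in> poly_space (int n - 1) UNIV"
  shows "\<exists>w\<in>poly_space (int n) UNIV. w s = x \<and> (\<forall>t. (w has_vector_derivative v t) (at t))"
proof -
  obtain a where a: "v = (\<lambda>t. \<Sum>j<n. t ^ j *\<^sub>R a j)"
    using assms unfolding poly_space_iff by auto
  define w0 where "w0 t = (\<Sum>j<n. t ^ Suc j *\<^sub>R (a j /\<^sub>R real (Suc j)))" for t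
  define w where "w t = w0 t + t ^ 0 *\<^sub>R (x - w0 s)" for t
  have "(w has_vector_derivative v t) (at t)" for t
    unfolding a w_def w0_def
    by (rule derivative_eq_intros refl | simp del: of_nat_Suc)+
      (auto intro!: sum.cong simp del: of_nat_Suc simp: field_simps)
  moreover have "w \<in> poly_space (int (Suc n) - 1) UNIV"
    unfolding w_def w0_def
    by (intro poly_space_add poly_space_sum poly_space_monomial) auto
  moreover have "w s = x"
    by (simp add: w_def)
  ultimately show ?thesis by auto
qed

section \<open>Integrals over bounded intervals\<close>

lemma set_integrable_Ioo_continuous:
  fixes f :: "real \<Rightarrow> 'a::euclidean_space"
  assumes "continuous_on {a..b} f"
  shows "set_integrable lebesgue {a<..<b} f"
proof (rule set_integrable_subset)
  show "set_integrable lebesgue {a..b} f"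
    using absolutely_integrable_continuous[of a b f] assms by simp
qed auto

text \<open>The loads \<open>t \<mapsto> F t (v t)\<close> are merely integrable, so their pairings with a polynomial exist because
  the polynomial is bounded on the interval.  The pairings needed below are \<open>\<bullet>\<close>, against test
  polynomials, and \<open>*\<^sub>R\<close>, against scalar basis polynomials.\<close>

lemma set_integrable_bilinear_continuous:
  fixes f :: "real \<Rightarrow> 'a::euclidean_space" and g :: "real \<Rightarrow> 'b::euclidean_space"
    and h :: "'b \<Rightarrow> 'a \<Rightarrow> 'c::euclidean_space"
  assumes h: "bounded_bilinear h"
    and f: "set_integrable lebesgue {a<..<b} f" and g: "continuous_on {a..b} g"
  shows "set_integrable lebesgue {a<..<b} (\<lambda>t. h (g t) (f t))"
proof -
  have "bilinear h"
    using bilinear_conv_bounded_bilinear h by blast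
  moreover have "bounded (g ` {a<..<b})"
    using compact_imp_bounded[OF compact_continuous_image[OF g compact_Icc]]
    by (rule bounded_subset) auto
  moreover have "g \<in> borel_measurable (lebesgue_on {a<..<b})"
    by (rule continuous_imp_measurable_on_sets_lebesgue)
      (use g in \<open>auto intro: continuous_on_subset\<close>)
  ultimately show ?thesis
    using absolutely_integrable_bounded_measurable_product[of h g "{a<..<b}" f] f
    by auto
qed

lemma set_integrable_inner_continuous:
  fixes f g :: "real \<Rightarrow> 'a::euclidean_space"
  assumes "set_integrable lebesgue {a<..<b} f" and "continuous_on {a..b} g"
  shows "set_integrable lebesgue {a<..<b} (\<lambda>t. f t \<bullet> g t)"
  using set_integrable_bilinear_continuous[OF bounded_bilinear_inner assms]
  by (simp add: inner_commute)

lemma LINT_Ioo_eq_integral: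
  fixes f :: "real \<Rightarrow> 'a::euclidean_space"
  assumes "continuous_on {a..b} f"
  shows "(LINT t:{a<..<b}|lebesgue. f t) = integral {a..b} f"
  using set_lebesgue_integral_eq_integral(2)[OF set_integrable_Ioo_continuous[OF assms]]
  by (simp add: integral_open_interval_real)

lemma L2_norm_nonneg: "0 \<le> L2_norm J f"
  by (simp add: L2_norm_def set_lebesgue_integral_def integral_nonneg_AE)

lemma L2_norm_power2: "(L2_norm J f)\<^sup>2 = (LINT t:J|lebesgue. (norm (f t))\<^sup>2)"
  by (simp add: L2_norm_def set_lebesgue_integral_def integral_nonneg_AE)

lemma L2_norm_eq_0_imp:
  fixes f :: "real \<Rightarrow> 'a::euclidean_space"
  assumes "a < b" and f: "continuous_on {a..b} f" and "L2_norm {a<..<b} f = 0" and "t \<in> {a..b}"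
  shows "f t = 0"
proof -
  have c: "continuous_on {a..b} (\<lambda>t. (norm (f t))\<^sup>2)"
    using f by (auto intro!: continuous_intros)
  have "integral {a..b} (\<lambda>t. (norm (f t))\<^sup>2) = 0"
    using L2_norm_power2[of "{a<..<b}" f] assms(3) LINT_Ioo_eq_integral[OF c] by simp
  then have "((\<lambda>t. (norm (f t))\<^sup>2) has_integral 0) (cbox a b)"
    using integrable_continuous_real[OF c] by (metis cbox_interval has_integral_integral)
  then have "(norm (f t))\<^sup>2 = 0"
    using has_integral_0_cbox_imp_0[of a b "\<lambda>t. (norm (f t))\<^sup>2" t] c assms(1,4) by auto
  then show ?thesis by simp
qed

text \<open>The quadratic polynomial \<open>s \<mapsto> \<integral> (s \<parallel>f\<parallel> - \<parallel>g\<parallel>)\<^sup>2\<close> is nonnegative, so its discriminant is not positive.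
  Norms are used under the integral because the Lipschitz condition bounds the nonlinearity
  only in norm.\<close>

lemma L2_Cauchy_Schwarz:
  fixes f g :: "real \<Rightarrow> 'a::euclidean_space"
  assumes f: "continuous_on {a..b} f" and g: "continuous_on {a..b} g"
  shows "(LINT t:{a<..<b}|lebesgue. norm (f t) * norm (g t)) \<le> L2_norm {a<..<b} f * L2_norm {a<..<b} g"
    (is "?Z \<le> _")
proof -
  let ?X = "LINT t:{a<..<b}|lebesgue. (norm (f t))\<^sup>2"
  let ?Y = "LINT t:{a<..<b}|lebesgue. (norm (g t))\<^sup>2"
  have i: "set_integrable lebesgue {a<..<b} (\<lambda>t. (norm (f t))\<^sup>2)"
    "set_integrable lebesgue {a<..<b} (\<lambda>t. (norm (g t))\<^sup>2)"
    "set_integrable lebesgue {a<..<b} (\<lambda>t. norm (f t) * norm (g t))"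
    by (intro set_integrable_Ioo_continuous continuous_intros f g)+
  have quad: "0 \<le> s\<^sup>2 * ?X + ?Y - 2 * s * ?Z" for s :: real
  proof -
    have "0 \<le> (LINT t:{a<..<b}|lebesgue. (s * norm (f t) - norm (g t))\<^sup>2)"
      by (simp add: set_lebesgue_integral_def integral_nonneg_AE)
    also have "\<dots> = (LINT t:{a<..<b}|lebesgue.
        s\<^sup>2 * (norm (f t))\<^sup>2 + (norm (g t))\<^sup>2 - (2 * s) * (norm (f t) * norm (g t)))"
      by (simp add: power2_eq_square algebra_simps)
    also have "\<dots> = s\<^sup>2 * ?X + ?Y - 2 * s * ?Z"
      using i by (simp add: set_integral_add set_integral_diff)
    finally show ?thesis .
  qed
  have X: "0 \<le> ?X" and Y: "0 \<le> ?Y"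
    by (simp_all add: set_lebesgue_integral_def integral_nonneg_AE)
  (* For positive ?X the best choice is the minimiser s = ?Z / ?X; for ?X = 0 a large s shows ?Z = 0. *)
  have "?Z\<^sup>2 \<le> ?X * ?Y"
  proof (cases "?X = 0")
    case True
    have "?Z = 0"
    proof (rule ccontr)
      assume "?Z \<noteq> 0"
      then show False
        using quad[of "(?Y + 1) / (2 * ?Z)"] True by simp
    qed
    then show ?thesis
      using True by simp
  next
    case False
    then show ?thesis
      using quad[of "?Z / ?X"] X by (simp add: field_simps power2_eq_square)
  qed
  then have "?Z \<le> sqrt (?X * ?Y)"
    by (rule real_le_rsqrt)
  then show ?thesis
    by (simp add: L2_norm_def real_sqrt_mult)
qed

section \<open>Orthonormal polynomials\<close>

text \<open>This is the Gram--Schmidt process on \<open>1, t, t\<^sup>2, \<dots>\<close>.  A monomial whose orthogonal remainder has norm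
  zero is skipped: the remainder then vanishes on the interval, so the monomial is already a
  combination of the earlier basis functions there.  For this reason the number \<open>m\<close> of basis functions
  is left open, and the monomials are represented on the interval only.\<close>

lemma orthonormal_polynomials:
  fixes a b :: real
  assumes "a < b"
  shows "\<exists>m (e :: nat \<Rightarrow> real \<Rightarrow> real).
    (\<forall>i<m. e i \<in> poly_space (int n - 1) UNIV) \<and>
    (\<forall>i<m. \<forall>j<m. (LINT t:{a<..<b}|lebesgue. e i t * e j t) = of_bool (i = j)) \<and>
    (\<forall>k<n. \<exists>c. \<forall>t\<in>{a<..<b}. t ^ k = (\<Sum>i<m. c i * e i t))"
proof (induction n)
  case 0
  show ?case by (rule exI[where x = 0]) simp
next
  case (Suc n)
  obtain m and e :: "nat \<Rightarrow> real \<Rightarrow> real"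
    where e: "\<forall>i<m. e i \<in> poly_space (int n - 1) UNIV"
      and on: "\<forall>i<m. \<forall>j<m. (LINT t:{a<..<b}|lebesgue. e i t * e j t) = of_bool (i = j)"
      and sp: "\<forall>k<n. \<exists>c. \<forall>t\<in>{a<..<b}. t ^ k = (\<Sum>i<m. c i * e i t)"
    using Suc.IH by blast
  have e': "e i \<in> poly_space (int (Suc n) - 1) UNIV" if "i < m" for i
    by (rule poly_space_mono[of "e i" "int n - 1"]) (use e that in auto)
  have ce: "continuous_on S (e i)" if "i < m" for i S
    using e that continuous_on_poly_space by blast
  define \<gamma> where "\<gamma> i = (LINT t:{a<..<b}|lebesgue. t ^ n * e i t)" for i
  define q where "q t = t ^ n - (\<Sum>i<m. \<gamma> i * e i t)" for t
  have qp: "q \<in> poly_space (int (Suc n) - 1) UNIV"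
    unfolding q_def
  proof (intro poly_space_diff poly_space_sum)
    show "(\<lambda>t. t ^ n) \<in> poly_space (int (Suc n) - 1) UNIV"
      using poly_space_monomial[of n "Suc n" "1 :: real"] by simp
    show "(\<lambda>t. \<gamma> i * e i t) \<in> poly_space (int (Suc n) - 1) UNIV" if "i \<in> {..<m}" for i
      using poly_space_bounded_linear[OF e' bounded_linear_mult_right, of i] that by simp
  qed
  then have cq: "continuous_on S q" for S
    by (rule continuous_on_poly_space)
  have orth: "(LINT t:{a<..<b}|lebesgue. q t * e j t) = 0" if "j < m" for j
  proof -
    have "(LINT t:{a<..<b}|lebesgue. q t * e j t) =
      integral {a..b} (\<lambda>t. t ^ n * e j t - (\<Sum>i<m. \<gamma> i * (e i t * e j t)))"
      by (subst LINT_Ioo_eq_integral)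
        (auto intro!: continuous_intros cq ce that simp: q_def algebra_simps sum_distrib_left)
    also have "\<dots> = integral {a..b} (\<lambda>t. t ^ n * e j t) -
        (\<Sum>i<m. \<gamma> i * integral {a..b} (\<lambda>t. e i t * e j t))"
      by (subst integral_diff integral_sum;
        auto intro!: integrable_continuous_real continuous_intros ce that integral_sum)+
    also have "integral {a..b} (\<lambda>t. t ^ n * e j t) = \<gamma> j"
      unfolding \<gamma>_def by (subst LINT_Ioo_eq_integral) (auto intro!: continuous_intros ce that)
    also have "(\<Sum>i<m. \<gamma> i * integral {a..b} (\<lambda>t. e i t * e j t)) = (\<Sum>i<m. \<gamma> i * of_bool (i = j))"
    proof (intro sum.cong refl)
      fix i assume "i \<in> {..<m}"
      then have "integral {a..b} (\<lambda>t. e i t * e j t) = of_bool (i = j)"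
        using on that
        by (subst LINT_Ioo_eq_integral[symmetric]) (auto intro!: continuous_intros ce)
      then show "\<gamma> i * integral {a..b} (\<lambda>t. e i t * e j t) = \<gamma> i * of_bool (i = j)"
        by simp
    qed
    also have "(\<Sum>i<m. \<gamma> i * of_bool (i = j)) = \<gamma> j"
      using that by (simp add: of_bool_def if_distrib cong: if_cong)
    finally show ?thesis by simp
  qed
  show ?case
  proof (cases "L2_norm {a<..<b} q = 0")
    case True
    then have "t ^ n = (\<Sum>i<m. \<gamma> i * e i t)" if "t \<in> {a<..<b}" for t
      using L2_norm_eq_0_imp[OF assms cq True, of t] that by (simp add: q_def)
    then show ?thesis
      using e' on sp by (intro exI[where x = m] exI[where x = e]) (auto simp: less_Suc_eq)
  next
    case False
    define \<nu> where "\<nu> = L2_norm {a<..<b} q"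
    define d where "d = (\<lambda>t. q t / \<nu>)"
    have \<nu>: "\<nu> \<noteq> 0" "(LINT t:{a<..<b}|lebesgue. q t * q t) = \<nu>\<^sup>2"
      using False L2_norm_power2[of "{a<..<b}" q] by (simp_all add: \<nu>_def power2_eq_square)
    define f where "f = e(m := d)"
    have fe: "f i = e i" if "i < m" for i
      using that by (simp add: f_def)
    have fm: "f m = d"
      by (simp add: f_def)
    have "f i \<in> poly_space (int (Suc n) - 1) UNIV" if "i < Suc m" for i
      using that e' poly_space_bounded_linear[OF qp bounded_linear_divide]
      by (auto simp: less_Suc_eq fe fm d_def)
    moreover have "(LINT t:{a<..<b}|lebesgue. f i t * f j t) = of_bool (i = j)"
      if "i < Suc m" "j < Suc m" for i j
    proof -
      have 1: "(LINT t:{a<..<b}|lebesgue. d t * e j t) = 0" if "j < m" for j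
        using orth[OF that] set_integral_mult_left[of lebesgue "{a<..<b}" "\<lambda>t. q t * e j t" "1 / \<nu>"]
        by (simp add: d_def)
      have 2: "(LINT t:{a<..<b}|lebesgue. d t * d t) = 1"
        using \<nu> set_integral_mult_left[of lebesgue "{a<..<b}" "\<lambda>t. q t * q t" "1 / \<nu>\<^sup>2"]
        by (simp add: d_def power2_eq_square)
      show ?thesis
        using that 1[of j] 1[of i] 2 on by (auto simp: less_Suc_eq fe fm mult.commute)
    qed
    moreover have "\<exists>c. \<forall>t\<in>{a<..<b}. t ^ k = (\<Sum>i<Suc m. c i * f i t)" if "k < Suc n" for k
    proof (cases "k = n")
      case True
      have "t ^ n = (\<Sum>i<Suc m. (\<gamma>(m := \<nu>)) i * f i t)" for t
        using \<nu>(1) by (simp add: fe fm d_def q_def)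
      then show ?thesis
        using True by blast
    next
      case False
      then have "k < n"
        using that by simp
      from sp[rule_format, OF this]
      obtain c where c: "\<forall>t\<in>{a<..<b}. t ^ k = (\<Sum>i<m. c i * e i t)" ..
      then have "\<forall>t\<in>{a<..<b}. t ^ k = (\<Sum>i<Suc m. (c(m := 0)) i * f i t)"
        by (simp add: fe)
      then show ?thesis by blast
    qed
    ultimately show ?thesis by blast
  qed
qed

section \<open>A fixed point theorem for sequences of coefficients\<close>

text \<open>Banach's fixed point theorem in the Euclidean norm on \<open>m\<close> coefficients.  The dimension \<open>m\<close> is a
  number and not a type, because it depends on the polynomial degree of the subinterval; hence
  the first \<open>m\<close> terms of a sequence stand for a vector.  The increments of the iteration decay
  geometrically, so every coefficient converges, and contractivity carries the fixed point
  equation to the limit.\<close>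

lemma l2_contraction_fixed_point:
  fixes \<Phi> :: "(nat \<Rightarrow> 'a::banach) \<Rightarrow> nat \<Rightarrow> 'a"
  assumes "0 \<le> \<kappa>" "\<kappa> < 1"
    and contr: "\<And>c d. L2_set (\<lambda>i. norm (\<Phi> c i - \<Phi> d i)) {..<m}
                   \<le> \<kappa> * L2_set (\<lambda>i. norm (c i - d i)) {..<m}"
  shows "\<exists>c. \<forall>i<m. \<Phi> c i = c i"
proof -
  define E where "E c d = L2_set (\<lambda>i. norm (c i - d i :: 'a)) {..<m}" for c d
  define x where "x n = (\<Phi> ^^ n) (\<lambda>_. 0)" for n
  have xS: "x (Suc n) = \<Phi> (x n)" for n
    by (simp add: x_def)
  have step: "E (x (Suc n)) (x n) \<le> \<kappa> ^ n * E (x 1) (x 0)" for n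
  proof (induction n)
    case (Suc n)
    have "E (x (Suc (Suc n))) (x (Suc n)) \<le> \<kappa> * E (x (Suc n)) (x n)"
      unfolding xS E_def by (rule contr)
    also have "\<dots> \<le> \<kappa> * (\<kappa> ^ n * E (x 1) (x 0))"
      using Suc assms(1) by (intro mult_left_mono)
    finally show ?case by simp
  qed simp
  have coord: "norm (c i - d i) \<le> E c d" if "i < m" for c d i
    unfolding E_def by (rule member_le_L2_set) (use that in auto)
  have "convergent (\<lambda>n. x n i)" if "i < m" for i
  proof -
    have "summable (\<lambda>n. \<kappa> ^ n * E (x 1) (x 0))"
      using assms by (intro summable_mult2 summable_geometric) simp
    then have "summable (\<lambda>n. x (Suc n) i - x n i)"
      by (rule summable_comparison_test'[where N = 0])
        (use coord[OF that] step order_trans in blast)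
    then have "convergent (\<lambda>n. (\<Sum>k<n. x (Suc k) i - x k i) + x 0 i)"
      unfolding summable_iff_convergent by (intro convergent_add convergent_const)
    then show ?thesis
      by (simp add: sum_lessThan_telescope[where f = "\<lambda>k. x k i"])
  qed
  then obtain c where c: "(\<lambda>n. x n i) \<longlonglongrightarrow> c i" if "i < m" for i
    unfolding convergent_def by metis
  have "(\<lambda>n. \<kappa> * E c (x n)) \<longlonglongrightarrow> \<kappa> * sqrt (\<Sum>i<m. (norm (c i - c i))\<^sup>2)"
    unfolding E_def L2_set_def by (intro tendsto_intros c) auto
  then have lim: "(\<lambda>n. \<kappa> * E c (x n)) \<longlonglongrightarrow> 0"
    by simp
  have "\<Phi> c i = c i" if "i < m" for i
  proof (rule LIMSEQ_unique)
    have "norm (\<Phi> c i - x (Suc n) i) \<le> \<kappa> * E c (x n)" for n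
      using coord[OF that, of "\<Phi> c" "\<Phi> (x n)"] contr[of c "x n"] unfolding xS E_def
      by (rule order_trans)
    then have "(\<lambda>n. \<Phi> c i - x (Suc n) i) \<longlonglongrightarrow> 0"
      using lim by (intro Lim_null_comparison[OF _ lim]) (auto intro: always_eventually)
    then have "(\<lambda>n. \<Phi> c i - (\<Phi> c i - x (Suc n) i)) \<longlonglongrightarrow> \<Phi> c i - 0"
      by (intro tendsto_intros)
    then show "(\<lambda>n. x (Suc n) i) \<longlonglongrightarrow> \<Phi> c i"
      by simp
    show "(\<lambda>n. x (Suc n) i) \<longlonglongrightarrow> c i"
      by (rule LIMSEQ_Suc[OF c[OF that]])
  qed
  then show ?thesis by blast
qed

section \<open>The problem on a single interval\<close>

text \<open>Test functions may jump at the nodes, so the Galerkin equations split into these equations, one for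
  every subinterval.\<close>

definition galerkin_eq ::
    "(real \<Rightarrow> 'a::euclidean_space \<Rightarrow> 'a) \<Rightarrow> nat \<Rightarrow> real set \<Rightarrow> (real \<Rightarrow> 'a) \<Rightarrow> bool" where
  "galerkin_eq F n J u \<longleftrightarrow>
     (\<forall>\<phi>\<in>poly_space (int n - 1) J.
        (LINT t:J|lebesgue. vector_derivative u (at t) \<bullet> \<phi> t) = (LINT t:J|lebesgue. F t (u t) \<bullet> \<phi> t))"

text \<open>For orthonormal \<open>e i\<close>, the moments of \<open>f\<close> are the coefficients of its \<open>L\<^sup>2\<close> projection.  Pairing them with
  coefficients \<open>d\<close> is the same as testing \<open>f\<close> with the function that has these coefficients, which
  makes sense for integrable \<open>f\<close> outside \<open>L\<^sup>2\<close> as well.\<close>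

lemma sum_moments:
  fixes f :: "real \<Rightarrow> 'a::euclidean_space" and e :: "nat \<Rightarrow> real \<Rightarrow> real"
  assumes f: "set_integrable lebesgue {a<..<b} f"
    and e: "\<And>i. i < m \<Longrightarrow> continuous_on {a..b} (e i)"
  shows "(\<Sum>i<m. (LINT t:{a<..<b}|lebesgue. e i t *\<^sub>R f t) \<bullet> d i) =
         (LINT t:{a<..<b}|lebesgue. f t \<bullet> (\<Sum>i<m. e i t *\<^sub>R d i))"
proof -
  have int: "set_integrable lebesgue {a<..<b} (\<lambda>t. e i t *\<^sub>R f t)" if "i < m" for i
    by (rule set_integrable_bilinear_continuous[OF bounded_bilinear_scaleR f e[OF that]])
  have "(\<Sum>i<m. (LINT t:{a<..<b}|lebesgue. e i t *\<^sub>R f t) \<bullet> d i) =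
        (\<Sum>i<m. integral\<^sup>L lebesgue (\<lambda>t. (indicator {a<..<b} t *\<^sub>R (e i t *\<^sub>R f t)) \<bullet> d i))"
    using int unfolding set_lebesgue_integral_def set_integrable_def
    by (intro sum.cong refl integral_inner_left[symmetric]) auto
  also have "\<dots> = integral\<^sup>L lebesgue (\<lambda>t. \<Sum>i<m. (indicator {a<..<b} t *\<^sub>R (e i t *\<^sub>R f t)) \<bullet> d i)"
    using int unfolding set_integrable_def
    by (intro Bochner_Integration.integral_sum[symmetric] integrable_inner_left) auto
  also have "\<dots> = (LINT t:{a<..<b}|lebesgue. f t \<bullet> (\<Sum>i<m. e i t *\<^sub>R d i))"
    unfolding set_lebesgue_integral_def
    by (intro Bochner_Integration.integral_cong refl) (simp add: inner_sum_right split: split_indicator)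
  finally show ?thesis .
qed

text \<open>The number \<open>\<kappa>\<close> stands for the length of the interval times the Poincare constant.  The Poincare inequality
  is asked for polynomials only, since differences of trial functions are polynomials on one
  subinterval.\<close>

locale galerkin_step =
  fixes F :: "real \<Rightarrow> 'a::euclidean_space \<Rightarrow> 'a" and a b L \<kappa> :: real and n :: nat
  assumes ab: "a < b" and L: "0 \<le> L" and \<kappa>: "0 \<le> \<kappa>" and small: "L * \<kappa> < 1"
    and lipschitz: "\<And>t v w. t \<in> {a<..<b} \<Longrightarrow> norm (F t v - F t w) \<le> L * norm (v - w)"
    and F_integrable: "\<And>v. v \<in> poly_space (int n) UNIV \<Longrightarrow>
          set_integrable lebesgue {a<..<b} (\<lambda>t. F t (v t))"
    and poincare: "\<And>w w' :: real \<Rightarrow> 'a. w \<in> poly_space (int n) UNIV \<Longrightarrow> w' \<in> poly_space (int n - 1) UNIV \<Longrightarrow>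
          (\<And>t. (w has_vector_derivative w' t) (at t)) \<Longrightarrow> w a = 0 \<Longrightarrow>
          L2_norm {a<..<b} w \<le> \<kappa> * L2_norm {a<..<b} w'"
begin

text \<open>The estimate behind both existence and uniqueness: the Lipschitz condition bounds the difference of
  the loads by the difference of the functions, the Cauchy--Schwarz inequality separates off the test
  function, and the Poincare inequality passes to the derivatives because the initial values agree.\<close>

lemma load_difference_estimate:
  assumes u: "u \<in> poly_space (int n) UNIV" "v \<in> poly_space (int n) UNIV"
    and u': "u' \<in> poly_space (int n - 1) UNIV" "v' \<in> poly_space (int n - 1) UNIV"
    and du: "\<And>t. (u has_vector_derivative u' t) (at t)" "\<And>t. (v has_vector_derivative v' t) (at t)"
    and init: "u a = v a" and \<phi>: "continuous_on {a..b} \<phi>"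
  shows "(LINT t:{a<..<b}|lebesgue. F t (u t) \<bullet> \<phi> t) - (LINT t:{a<..<b}|lebesgue. F t (v t) \<bullet> \<phi> t)
    \<le> L * \<kappa> * L2_norm {a<..<b} (\<lambda>t. u' t - v' t) * L2_norm {a<..<b} \<phi>"
proof -
  have cw: "continuous_on S (\<lambda>t. u t - v t)" for S
    by (intro continuous_intros continuous_on_poly_space[OF u(1)] continuous_on_poly_space[OF u(2)])
  note iu = set_integrable_inner_continuous[OF F_integrable[OF u(1)] \<phi>]
  note iv = set_integrable_inner_continuous[OF F_integrable[OF u(2)] \<phi>]
  have "(LINT t:{a<..<b}|lebesgue. F t (u t) \<bullet> \<phi> t) - (LINT t:{a<..<b}|lebesgue. F t (v t) \<bullet> \<phi> t)
      = (LINT t:{a<..<b}|lebesgue. F t (u t) \<bullet> \<phi> t - F t (v t) \<bullet> \<phi> t)"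
    using set_integral_diff(2)[OF iu iv] by simp
  also have "\<dots> \<le> (LINT t:{a<..<b}|lebesgue. L * (norm (u t - v t) * norm (\<phi> t)))"
  proof (rule set_integral_mono[OF set_integral_diff(1)[OF iu iv]])
    show "set_integrable lebesgue {a<..<b} (\<lambda>t. L * (norm (u t - v t) * norm (\<phi> t)))"
      by (intro set_integrable_Ioo_continuous continuous_intros cw \<phi>)
    show "F t (u t) \<bullet> \<phi> t - F t (v t) \<bullet> \<phi> t \<le> L * (norm (u t - v t) * norm (\<phi> t))"
      if "t \<in> {a<..<b}" for t
    proof -
      have "F t (u t) \<bullet> \<phi> t - F t (v t) \<bullet> \<phi> t \<le> norm (F t (u t) - F t (v t)) * norm (\<phi> t)"
        using norm_cauchy_schwarz[of "F t (u t) - F t (v t)" "\<phi> t"] by (simp add: inner_diff_left)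
      also have "\<dots> \<le> (L * norm (u t - v t)) * norm (\<phi> t)"
        by (intro mult_right_mono lipschitz that norm_ge_zero)
      finally show ?thesis by (simp add: mult.assoc)
    qed
  qed
  also have "\<dots> = L * (LINT t:{a<..<b}|lebesgue. norm (u t - v t) * norm (\<phi> t))"
    by simp
  also have "\<dots> \<le> L * (L2_norm {a<..<b} (\<lambda>t. u t - v t) * L2_norm {a<..<b} \<phi>)"
    by (intro mult_left_mono L2_Cauchy_Schwarz cw \<phi> L)
  also have "\<dots> \<le> L * ((\<kappa> * L2_norm {a<..<b} (\<lambda>t. u' t - v' t)) * L2_norm {a<..<b} \<phi>)"
    by (intro mult_left_mono mult_right_mono poincare L L2_norm_nonneg poly_space_diff u u'
          has_vector_derivative_diff du)
      (simp add: init)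
  finally show ?thesis by (simp add: mult.assoc)
qed

text \<open>The derivative of the difference of two solutions is itself an admissible test function \<open>e\<close>.  Testing
  with it gives \<open>\<parallel>e\<parallel>\<^sup>2 \<le> L \<kappa> \<parallel>e\<parallel>\<^sup>2\<close> with \<open>L \<kappa> < 1\<close>, so \<open>e\<close> is zero.\<close>

lemma galerkin_unique:
  assumes u: "u \<in> poly_space (int n) UNIV" "galerkin_eq F n {a<..<b} u"
    and v: "v \<in> poly_space (int n) UNIV" "galerkin_eq F n {a<..<b} v"
    and init: "u a = v a" and t: "t \<in> {a..b}"
  shows "u t = v t"
proof -
  obtain u' where u': "u' \<in> poly_space (int n - 1) UNIV" "\<And>t. (u has_vector_derivative u' t) (at t)"
    using poly_space_derivative[OF u(1)] by blast
  obtain v' where v': "v' \<in> poly_space (int n - 1) UNIV" "\<And>t. (v has_vector_derivative v' t) (at t)"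
    using poly_space_derivative[OF v(1)] by blast
  define e where "e t = u' t - v' t" for t
  have e: "e \<in> poly_space (int n - 1) UNIV"
    unfolding e_def by (intro poly_space_diff u' v')
  have ce: "continuous_on S e" for S
    using e by (rule continuous_on_poly_space)
  have eJ: "e \<in> poly_space (int n - 1) {a<..<b}"
    using e by (rule poly_space_subset) simp
  have "(L2_norm {a<..<b} e)\<^sup>2 = (LINT t:{a<..<b}|lebesgue. u' t \<bullet> e t - v' t \<bullet> e t)"
    by (simp add: L2_norm_power2 e_def dot_square_norm[symmetric] inner_diff_left)
  also have "\<dots> = (LINT t:{a<..<b}|lebesgue. u' t \<bullet> e t) - (LINT t:{a<..<b}|lebesgue. v' t \<bullet> e t)"
    by (intro set_integral_diff set_integrable_Ioo_continuous continuous_intros ce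
          continuous_on_poly_space[OF u'(1)] continuous_on_poly_space[OF v'(1)])
  also have "\<dots> = (LINT t:{a<..<b}|lebesgue. F t (u t) \<bullet> e t) - (LINT t:{a<..<b}|lebesgue. F t (v t) \<bullet> e t)"
    using u(2) v(2) eJ unfolding galerkin_eq_def
    by (simp add: vector_derivative_at[OF u'(2)] vector_derivative_at[OF v'(2)])
  also have "\<dots> \<le> L * \<kappa> * L2_norm {a<..<b} e * L2_norm {a<..<b} e"
    using load_difference_estimate[OF u(1) v(1) u'(1) v'(1) u'(2) v'(2) init ce] 
    by (simp add: e_def[abs_def])
  finally have "(1 - L * \<kappa>) * (L2_norm {a<..<b} e)\<^sup>2 \<le> 0"
    by (simp add: power2_eq_square algebra_simps)
  then have "L2_norm {a<..<b} e = 0"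
    using small by (auto simp: mult_le_0_iff)
  moreover have "L2_norm {a<..<b} (\<lambda>t. u t - v t) \<le> \<kappa> * L2_norm {a<..<b} e"
    by (rule poincare[OF poly_space_diff[OF u(1) v(1)] e])
      (auto simp: e_def init intro: has_vector_derivative_diff u' v')
  ultimately have "L2_norm {a<..<b} (\<lambda>t. u t - v t) = 0"
    using L2_norm_nonneg[of "{a<..<b}" "\<lambda>t. u t - v t"] by simp
  moreover have "continuous_on {a..b} (\<lambda>t. u t - v t)"
    by (intro continuous_intros continuous_on_poly_space[OF u(1)] continuous_on_poly_space[OF v(1)])
  ultimately have "u t - v t = 0"
    using L2_norm_eq_0_imp[OF ab _ _ t, of "\<lambda>t. u t - v t"] by blast
  then show ?thesis by simp
qed

text \<open>The unknown is the derivative of the solution, given by its coefficients \<open>c\<close> with respect to an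
  orthonormal basis of the test space.  With \<open>u c\<close> the primitive that takes the initial value, the
  equation says that \<open>c\<close> is a fixed point of the map \<open>\<Phi>\<close> sending \<open>c\<close> to the moments of
  \<open>t \<mapsto> F t (u c t)\<close>.  Orthonormality turns the Euclidean norm of coefficients into the
  \<open>L\<^sup>2\<close> norm, so the load estimate makes \<open>\<Phi>\<close> a contraction with factor \<open>L \<kappa>\<close>.\<close>

lemma galerkin_exists:
  "\<exists>u\<in>poly_space (int n) UNIV. u a = x \<and> galerkin_eq F n {a<..<b} u"
proof -
  obtain m and e :: "nat \<Rightarrow> real \<Rightarrow> real"
    where ep: "\<And>i. i < m \<Longrightarrow> e i \<in> poly_space (int n - 1) UNIV"
      and on: "\<And>i j. i < m \<Longrightarrow> j < m \<Longrightarrow>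
                 (LINT t:{a<..<b}|lebesgue. e i t * e j t) = of_bool (i = j)"
      and sp: "\<forall>k<n. \<exists>c. \<forall>t\<in>{a<..<b}. t ^ k = (\<Sum>i<m. c i * e i t)"
    using orthonormal_polynomials[OF ab, of n] by blast
  obtain M where M: "\<And>k t. k < n \<Longrightarrow> t \<in> {a<..<b} \<Longrightarrow> t ^ k = (\<Sum>i<m. M k i * e i t)"
    using sp by metis
  have ce: "continuous_on S (e i)" if "i < m" for i S
    using ep[OF that] by (rule continuous_on_poly_space)
  (* D c is the function with coefficients c; on the interval these functions exhaust the test space. *)
  define D :: "(nat \<Rightarrow> 'a) \<Rightarrow> real \<Rightarrow> 'a" where "D c t = (\<Sum>i<m. e i t *\<^sub>R c i)" for c t
  have D: "D c \<in> poly_space (int n - 1) UNIV" for c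
    unfolding D_def
    by (intro poly_space_sum poly_space_bounded_linear[OF ep bounded_linear_scaleR_left]) auto
  have cD: "continuous_on S (D c)" for S c
    using D by (rule continuous_on_poly_space)
  have D_onto: "\<exists>c. \<forall>t\<in>{a<..<b}. \<phi> t = D c t" if "\<phi> \<in> poly_space (int n - 1) {a<..<b}" for \<phi> :: "real \<Rightarrow> 'a"
  proof -
    from that[unfolded poly_space_iff]
    obtain p where p: "\<forall>t\<in>{a<..<b}. \<phi> t = (\<Sum>k<n. t ^ k *\<^sub>R p k)" ..
    have "\<phi> t = D (\<lambda>i. \<Sum>k<n. M k i *\<^sub>R p k) t" if "t \<in> {a<..<b}" for t
    proof -
      have "\<phi> t = (\<Sum>k<n. (\<Sum>i<m. M k i * e i t) *\<^sub>R p k)"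
        using p that M by simp
      also have "\<dots> = D (\<lambda>i. \<Sum>k<n. M k i *\<^sub>R p k) t"
        unfolding D_def scaleR_sum_left scaleR_sum_right
        by (subst sum.swap) (simp add: mult.commute)
      finally show ?thesis .
    qed
    then show ?thesis by blast
  qed
  have pair: "(\<Sum>i<m. (LINT t:{a<..<b}|lebesgue. e i t *\<^sub>R f t) \<bullet> d i) =
              (LINT t:{a<..<b}|lebesgue. f t \<bullet> D d t)"
    if "set_integrable lebesgue {a<..<b} f" for f d
    unfolding D_def by (rule sum_moments[OF that ce])
  have coeff: "(LINT t:{a<..<b}|lebesgue. e i t *\<^sub>R D c t) = c i" if "i < m" for i c
  proof -
    have "(LINT t:{a<..<b}|lebesgue. e i t *\<^sub>R D c t) = integral {a..b} (\<lambda>t. \<Sum>j<m. (e i t * e j t) *\<^sub>R c j)"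
      by (subst LINT_Ioo_eq_integral)
        (auto intro!: continuous_intros ce cD that simp: D_def scaleR_sum_right)
    also have "\<dots> = (\<Sum>j<m. integral {a..b} (\<lambda>t. (e i t * e j t) *\<^sub>R c j))"
      by (intro integral_sum) (auto intro!: integrable_continuous_real continuous_intros ce that)
    also have "\<dots> = (\<Sum>j<m. of_bool (i = j) *\<^sub>R c j)"
    proof (intro sum.cong refl)
      fix j assume "j \<in> {..<m}"
      then have "integral {a..b} (\<lambda>t. e i t * e j t) = of_bool (i = j)"
        using on[of i j] that
        by (subst LINT_Ioo_eq_integral[symmetric]) (auto intro!: continuous_intros ce)
      moreover have "(\<lambda>t. e i t * e j t) integrable_on {a..b}"
        using \<open>j \<in> {..<m}\<close> that by (auto intro!: integrable_continuous_real continuous_intros ce)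
      ultimately show "integral {a..b} (\<lambda>t. (e i t * e j t) *\<^sub>R c j) = of_bool (i = j) *\<^sub>R c j"
        using integral_linear[of "\<lambda>t. e i t * e j t" "{a..b}" "\<lambda>x. x *\<^sub>R c j"]
        by (simp add: o_def bounded_linear_scaleR_left)
    qed
    also have "\<dots> = c i"
      using that by (simp add: of_bool_def if_distrib[where f = "\<lambda>x. x *\<^sub>R _"] cong: if_cong)
    finally show ?thesis .
  qed
  have parseval: "(\<Sum>i<m. c i \<bullet> d i) = (LINT t:{a<..<b}|lebesgue. D c t \<bullet> D d t)" for c d
    using pair[OF set_integrable_Ioo_continuous[OF cD], of c d] coeff by simp
  have norm_D: "L2_norm {a<..<b} (D c) = L2_set (\<lambda>i. norm (c i)) {..<m}" for c
    using parseval[of c c] by (simp add: L2_norm_def L2_set_def dot_square_norm)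
  have D_diff: "D c t - D d t = D (\<lambda>i. c i - d i) t" for c d t
    by (simp add: D_def sum_subtractf scaleR_diff_right)

  have "\<forall>c. \<exists>w\<in>poly_space (int n) UNIV. w a = x \<and> (\<forall>t. (w has_vector_derivative D c t) (at t))"
    using poly_space_primitive[OF D] by blast
  then obtain u where u: "\<And>c. u c \<in> poly_space (int n) UNIV" "\<And>c. u c a = x"
      "\<And>c t. (u c has_vector_derivative D c t) (at t)"
    by metis
  define \<Phi> where "\<Phi> c i = (LINT t:{a<..<b}|lebesgue. e i t *\<^sub>R F t (u c t))" for c i
  have \<Phi>_pair: "(\<Sum>i<m. \<Phi> c i \<bullet> d i) = (LINT t:{a<..<b}|lebesgue. F t (u c t) \<bullet> D d t)" for c d
    unfolding \<Phi>_def by (rule pair[OF F_integrable[OF u(1)]])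
  have "L2_set (\<lambda>i. norm (\<Phi> c i - \<Phi> d i)) {..<m} \<le> (L * \<kappa>) * L2_set (\<lambda>i. norm (c i - d i)) {..<m}"
    (is "?E \<le> _ * ?E'") for c d
  proof -
    (* Duality: the increment of \<Phi> is estimated by testing with the polynomial that has this same
       increment as coefficients; the loads then enter only through their difference. *)
    define \<delta> where "\<delta> i = \<Phi> c i - \<Phi> d i" for i
    have "?E\<^sup>2 = (\<Sum>i<m. \<delta> i \<bullet> \<delta> i)"
      by (simp add: L2_set_def sum_nonneg \<delta>_def dot_square_norm)
    also have "\<dots> = (\<Sum>i<m. \<Phi> c i \<bullet> \<delta> i) - (\<Sum>i<m. \<Phi> d i \<bullet> \<delta> i)"
      unfolding sum_subtractf[symmetric] inner_diff_left[symmetric] by (simp add: \<delta>_def)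
    also have "\<dots> \<le> L * \<kappa> * L2_norm {a<..<b} (\<lambda>t. D c t - D d t) * L2_norm {a<..<b} (D \<delta>)"
      unfolding \<Phi>_pair
      by (rule load_difference_estimate[OF u(1) u(1) D D u(3) u(3)]) (simp_all add: u(2) cD)
    also have "\<dots> = (L * \<kappa>) * ?E' * ?E"
      by (simp add: D_diff norm_D[unfolded D_def[abs_def]] norm_D \<delta>_def)
    finally have le: "?E * ?E \<le> ((L * \<kappa>) * ?E') * ?E"
      by (simp add: power2_eq_square)
    show ?thesis
    proof (cases "?E = 0")
      case True
      then show ?thesis
        using L \<kappa> by simp
    next
      case False
      then have "0 < ?E"
        using L2_set_nonneg by (metis less_eq_real_def)
      then show ?thesis
        using le by (simp only: mult_le_cancel_right_pos)
    qed
  qed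
  then obtain c where c: "\<And>i. i < m \<Longrightarrow> \<Phi> c i = c i"
    using l2_contraction_fixed_point[of "L * \<kappa>" \<Phi> m] L \<kappa> small by auto
  have "galerkin_eq F n {a<..<b} (u c)"
    unfolding galerkin_eq_def
  proof
    fix \<phi> :: "real \<Rightarrow> 'a"
    assume "\<phi> \<in> poly_space (int n - 1) {a<..<b}"
    then obtain d where d: "\<forall>t\<in>{a<..<b}. \<phi> t = D d t"
      using D_onto by blast
    have "(LINT t:{a<..<b}|lebesgue. vector_derivative (u c) (at t) \<bullet> \<phi> t) =
          (LINT t:{a<..<b}|lebesgue. D c t \<bullet> D d t)"
      by (rule set_lebesgue_integral_cong) (auto simp: d vector_derivative_at[OF u(3)])
    also have "\<dots> = (LINT t:{a<..<b}|lebesgue. F t (u c t) \<bullet> D d t)"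
      using parseval[of c d] \<Phi>_pair[of c d] c by simp
    also have "\<dots> = (LINT t:{a<..<b}|lebesgue. F t (u c t) \<bullet> \<phi> t)"
      by (rule set_lebesgue_integral_cong) (auto simp: d)
    finally show "(LINT t:{a<..<b}|lebesgue. vector_derivative (u c) (at t) \<bullet> \<phi> t) =
          (LINT t:{a<..<b}|lebesgue. F t (u c t) \<bullet> \<phi> t)" .
  qed
  then show ?thesis
    using u by blast
qed

end

section \<open>Weak derivatives of piecewise smooth functions\<close>

lemma set_integrable_bounded_Ioo:
  fixes g :: "real \<Rightarrow> 'a::euclidean_space"
  assumes "g \<in> borel_measurable lebesgue" and "\<And>t. norm (g t) \<le> B"
  shows "set_integrable lebesgue {a<..<b} g"
  unfolding set_integrable_def
  by (rule integrableI_bounded_set_indicator[where B = B]) 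
    (use assms emeasure_bounded_finite[of "{a<..<b}"] in auto)

lemma bounded_in_L2_space:
  fixes g :: "real \<Rightarrow> 'a::euclidean_space"
  assumes g: "g \<in> borel_measurable lebesgue" and B: "\<And>t. norm (g t) \<le> B"
  shows "g \<in> L2_space {a<..<b}"
proof -
  have "norm ((norm (g t))\<^sup>2) \<le> B\<^sup>2" for t
    using power_mono[OF B norm_ge_zero, of t 2] by simp
  then have "set_integrable lebesgue {a<..<b} (\<lambda>t. (norm (g t))\<^sup>2)"
    by (intro set_integrable_bounded_Ioo[where B = "B\<^sup>2"]) (use g in measurable)
  moreover have "set_borel_measurable lebesgue {a<..<b} g"
    using set_integrable_bounded_Ioo[OF g B]
    unfolding set_borel_measurable_def set_integrable_def by (rule borel_measurable_integrable)
  ultimately show ?thesis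
    unfolding L2_space_def by blast
qed

lemma continuous_in_L2_space:
  fixes f :: "real \<Rightarrow> 'a::euclidean_space"
  assumes f: "continuous_on {a..b} f"
  shows "f \<in> L2_space {a<..<b}"
proof -
  have "set_integrable lebesgue {a<..<b} (\<lambda>t. (norm (f t))\<^sup>2)"
    by (intro set_integrable_Ioo_continuous continuous_intros f)
  moreover have "set_borel_measurable lebesgue {a<..<b} f"
    using set_integrable_Ioo_continuous[OF f]
    unfolding set_borel_measurable_def set_integrable_def by (rule borel_measurable_integrable)
  ultimately show ?thesis
    unfolding L2_space_def by blast
qed

lemma indicator_continuous_bounded:
  fixes f :: "real \<Rightarrow> 'a::euclidean_space"
  assumes f: "continuous_on {a..b} f"
  shows "(\<lambda>t. indicator {a<..<b} t *\<^sub>R f t) \<in> borel_measurable lebesgue"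
    and "\<exists>B. \<forall>t. norm (indicator {a<..<b} t *\<^sub>R f t) \<le> B"
proof -
  show "(\<lambda>t. indicator {a<..<b} t *\<^sub>R f t) \<in> borel_measurable lebesgue"
    using set_integrable_Ioo_continuous[OF f] unfolding set_integrable_def
    by (rule borel_measurable_integrable)
  obtain B where "\<And>t. t \<in> {a..b} \<Longrightarrow> norm (f t) \<le> B"
    using compact_imp_bounded[OF compact_continuous_image[OF f compact_Icc]]
    unfolding bounded_iff by blast
  then have "norm (indicator {a<..<b} t *\<^sub>R f t) \<le> \<bar>B\<bar>" for t
    by (cases "t \<in> {a<..<b}") (auto intro: order_trans[OF _ abs_ge_self])
  then show "\<exists>B. \<forall>t. norm (indicator {a<..<b} t *\<^sub>R f t) \<le> B"
    by blast
qed

text \<open>Integration by parts: \<open>\<psi> x\<close> is continuous and vanishes at both ends, and finitely many kinks do no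
  harm to the fundamental theorem of calculus for continuous functions.\<close>

lemma is_weak_deriv_piecewise:
  fixes x g :: "real \<Rightarrow> 'a::euclidean_space"
  assumes "a < b" "finite S" and x: "continuous_on {a..b} x"
    and dx: "\<And>t. t \<in> {a<..<b} - S \<Longrightarrow> (x has_vector_derivative g t) (at t)"
    and g: "set_integrable lebesgue {a<..<b} g"
  shows "is_weak_deriv {a<..<b} x g"
  unfolding is_weak_deriv_def
proof
  fix \<psi> assume "\<psi> \<in> test_functions {a<..<b}"
  then have diff: "(deriv ^^ m) \<psi> field_differentiable at t"
    and supp: "closure {t. \<psi> t \<noteq> 0} \<subseteq> {a<..<b}" for m t
    unfolding test_functions_def by auto
  have d\<psi>: "(\<psi> has_vector_derivative deriv \<psi> t) (at t)" for t
    using diff[of 0 t] by (simp add: field_differentiable_derivI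
        has_real_derivative_iff_has_vector_derivative[symmetric])
  have c\<psi>: "continuous_on {a..b} \<psi>"
    using diff[of 0]
    by (auto intro!: continuous_at_imp_continuous_on field_differentiable_imp_continuous_at)
  have cd\<psi>: "continuous_on {a..b} (deriv \<psi>)"
    using diff[of 1]
    by (auto intro!: continuous_at_imp_continuous_on field_differentiable_imp_continuous_at)
  have zero: "\<psi> a = 0" "\<psi> b = 0"
    using supp closure_subset[of "{t. \<psi> t \<noteq> 0}"] by fastforce+
  have i1: "set_integrable lebesgue {a<..<b} (\<lambda>t. deriv \<psi> t *\<^sub>R x t)"
    by (intro set_integrable_Ioo_continuous continuous_intros cd\<psi> x)
  have i2: "set_integrable lebesgue {a<..<b} (\<lambda>t. \<psi> t *\<^sub>R g t)"
    by (rule set_integrable_bilinear_continuous[OF bounded_bilinear_scaleR g c\<psi>])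
  have "((\<lambda>t. deriv \<psi> t *\<^sub>R x t + \<psi> t *\<^sub>R g t) has_integral (\<psi> b *\<^sub>R x b - \<psi> a *\<^sub>R x a)) {a..b}"
  proof (rule fundamental_theorem_of_calculus_interior_strong[OF assms(2)])
    show "((\<lambda>t. \<psi> t *\<^sub>R x t) has_vector_derivative deriv \<psi> t *\<^sub>R x t + \<psi> t *\<^sub>R g t) (at t)"
      if "t \<in> {a<..<b} - S" for t
      using bounded_bilinear.has_vector_derivative[OF bounded_bilinear_scaleR d\<psi> dx[OF that]]
      by (simp add: add.commute)
  qed (use assms(1) in \<open>auto intro!: continuous_intros c\<psi> x\<close>)
  then have "integral {a<..<b} (\<lambda>t. deriv \<psi> t *\<^sub>R x t + \<psi> t *\<^sub>R g t) = 0"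
    unfolding integral_open_interval_real[symmetric] zero by (simp add: integral_unique)
  then have "(LINT t:{a<..<b}|lebesgue. deriv \<psi> t *\<^sub>R x t + \<psi> t *\<^sub>R g t) = 0"
    using set_lebesgue_integral_eq_integral(2)[OF set_integral_add(1)[OF i1 i2]] by simp
  then show "(LINT t:{a<..<b}|lebesgue. deriv \<psi> t *\<^sub>R x t) =
      - (LINT t:{a<..<b}|lebesgue. \<psi> t *\<^sub>R g t)"
    using set_integral_add(2)[OF i1 i2] by (simp add: eq_neg_iff_add_eq_0)
qed

section \<open>Partitions\<close>

lemma nodes_mono:
  fixes \<tau> :: "nat \<Rightarrow> real"
  assumes "\<forall>n\<in>{1..N}. \<tau> (n - 1) < \<tau> n" and "i \<le> j" "j \<le> N"
  shows "\<tau> i \<le> \<tau> j"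
  using assms(2,3)
proof (induction j rule: dec_induct)
  case (step j)
  then show ?case
    using assms(1)[rule_format, of "Suc j"] by simp
qed simp

lemma ends_less:
  fixes \<tau> :: "nat \<Rightarrow> real"
  assumes "\<forall>n\<in>{1..N}. \<tau> (n - 1) < \<tau> n" and "0 < N"
  shows "\<tau> 0 < \<tau> N"
proof -
  have "\<tau> 0 \<le> \<tau> (N - 1)"
    by (rule nodes_mono[OF assms(1)]) auto
  also have "\<dots> < \<tau> N"
    using assms by simp
  finally show ?thesis .
qed

lemma subint_disjoint:
  assumes "\<forall>n\<in>{1..N}. \<tau> (n - 1) < \<tau> n" and "m \<in> {1..N}" "n \<in> {1..N}"
    and t: "t \<in> subint \<tau> m" "t \<in> subint \<tau> n"
  shows "m = n"
proof -
  have "\<not> i < j" if "i \<in> {1..N}" "j \<in> {1..N}" "t \<in> subint \<tau> i" "t \<in> subint \<tau> j" for i j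
  proof
    assume "i < j"
    then have "\<tau> i \<le> \<tau> (j - 1)"
      using that by (intro nodes_mono[OF assms(1)]) auto
    then show False
      using that by (simp add: subint_def)
  qed
  then show ?thesis
    using assms by (metis linorder_neqE_nat)
qed

lemma subint_cover:
  assumes "t \<in> {\<tau> 0<..<\<tau> N} - \<tau> ` {..N}"
  shows "\<exists>n\<in>{1..N}. t \<in> subint \<tau> n"
  using assms
proof (induction N)
  case (Suc N)
  show ?case
  proof (cases "t < \<tau> N")
    case True
    then have "t \<in> {\<tau> 0<..<\<tau> N} - \<tau> ` {..N}"
      using Suc.prems by auto
    then show ?thesis
      using Suc.IH by force
  next
    case False
    then have "t \<in> subint \<tau> (Suc N)"
      using Suc.prems by (auto simp: subint_def less_le)
    then show ?thesis by force
  qed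
qed simp

text \<open>Time stepping: the terminal value of one piece is the initial value of the next.\<close>

lemma glue_pieces:
  fixes \<tau> :: "nat \<Rightarrow> real" and P :: "nat \<Rightarrow> (real \<Rightarrow> 'a::topological_space) \<Rightarrow> bool"
  assumes nodes: "\<forall>n\<in>{1..N}. \<tau> (n - 1) < \<tau> n"
    and step: "\<And>n x. n \<in> {1..N} \<Longrightarrow> \<exists>v. continuous_on UNIV v \<and> v (\<tau> (n - 1)) = x \<and> P n v"
  shows "\<exists>U v. continuous_on {\<tau> 0..\<tau> N} U \<and> U (\<tau> 0) = x \<and>
           (\<forall>n\<in>{1..N}. P n (v n) \<and> (\<forall>t\<in>{\<tau> (n - 1)..\<tau> n}. U t = v n t))"
  using assms
proof (induction N)
  case 0
  show ?case by (rule exI[where x = "\<lambda>_. x"]) simp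
next
  case (Suc N)
  obtain U v where U: "continuous_on {\<tau> 0..\<tau> N} U" "U (\<tau> 0) = x"
    and v: "\<And>n. n \<in> {1..N} \<Longrightarrow> P n (v n)"
    and Uv: "\<And>n t. n \<in> {1..N} \<Longrightarrow> t \<in> {\<tau> (n - 1)..\<tau> n} \<Longrightarrow> U t = v n t"
    using Suc by force
  obtain w where w: "continuous_on UNIV w" "w (\<tau> N) = U (\<tau> N)" "P (Suc N) w"
    using Suc.prems(2)[of "Suc N" "U (\<tau> N)"] by auto
  have lt: "\<tau> N < \<tau> (Suc N)"
    using Suc.prems(1) by force
  have le: "\<tau> n \<le> \<tau> N" if "n \<le> N" for n
    by (rule nodes_mono[OF Suc.prems(1)]) (use that in auto)
  define V where "V t = (if t \<le> \<tau> N then U t else w t)" for t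
  have "continuous_on {\<tau> 0..\<tau> (Suc N)} V"
    unfolding V_def
  proof (rule continuous_on_cases_le)
    show "continuous_on {t \<in> {\<tau> 0..\<tau> (Suc N)}. t \<le> \<tau> N} U"
      by (rule continuous_on_subset[OF U(1)]) auto
    show "continuous_on {t \<in> {\<tau> 0..\<tau> (Suc N)}. \<tau> N \<le> t} w"
      by (rule continuous_on_subset[OF w(1)]) auto
  qed (use w in auto)
  moreover have "V (\<tau> 0) = x"
    using le[of 0] U by (simp add: V_def)
  moreover have "P n ((v(Suc N := w)) n) \<and> (\<forall>t\<in>{\<tau> (n - 1)..\<tau> n}. V t = (v(Suc N := w)) n t)"
    if n: "n \<in> {1..Suc N}" for n
  proof (cases "n = Suc N")
    case True
    then show ?thesis
      using w lt by (auto simp: V_def)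
  next
    case False
    then have "n \<in> {1..N}"
      using n by auto
    then show ?thesis
      using v Uv le[of n] False by (auto simp: V_def)
  qed
  ultimately show ?case by blast
qed

section \<open>The method on the whole interval\<close>

text \<open>Agreement on the closed subintervals makes neighbouring pieces meet at the nodes.  The pieces are
  polynomials on the whole line and thus differentiable everywhere, while \<open>U\<close> may have kinks at the
  nodes.\<close>

definition spline_with ::
    "nat \<Rightarrow> (nat \<Rightarrow> real) \<Rightarrow> (nat \<Rightarrow> nat) \<Rightarrow> (nat \<Rightarrow> real \<Rightarrow> 'a::euclidean_space) \<Rightarrow> (real \<Rightarrow> 'a) \<Rightarrow> bool" where
  "spline_with N \<tau> r v U \<longleftrightarrow> (\<forall>n\<in>{1..N}. v n \<in> poly_space (int (r n)) UNIV \<and>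
     (\<forall>t\<in>{\<tau> (n - 1)..\<tau> n}. U t = v n t))"

text \<open>Membership in the trial space fixes \<open>U\<close> as a polynomial on open subintervals only; continuity extends
  this to the nodes.\<close>

lemma trial_space_pieces:
  assumes nodes: "\<forall>n\<in>{1..N}. \<tau> (n - 1) < \<tau> n" and N: "0 < N" and U: "U \<in> trial_space N \<tau> r"
  shows "\<exists>v. spline_with N \<tau> r v U"
proof -
  have cU: "continuous_on {\<tau> 0..\<tau> N} U"
    using U ends_less[OF nodes N] by (simp add: trial_space_def H1_space_def)
  have "\<exists>v\<in>poly_space (int (r n)) UNIV. \<forall>t\<in>{\<tau> (n - 1)..\<tau> n}. U t = v t" if n: "n \<in> {1..N}" for n
  proof -
    obtain v where v: "v \<in> poly_space (int (r n)) UNIV" "\<forall>t\<in>subint \<tau> n. U t = v t"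
      using poly_space_extension U n unfolding trial_space_def by blast
    have cl: "closure {\<tau> (n - 1)<..<\<tau> n} = {\<tau> (n - 1)..\<tau> n}"
      using nodes n by simp
    have "\<tau> 0 \<le> \<tau> (n - 1)" "\<tau> n \<le> \<tau> N"
      using n by (auto intro!: nodes_mono[OF nodes])
    then have "continuous_on (closure {\<tau> (n - 1)<..<\<tau> n}) (\<lambda>t. U t - v t)"
      unfolding cl
      by (intro continuous_on_diff continuous_on_poly_space[OF v(1)] continuous_on_subset[OF cU]) auto
    moreover have "U t - v t = 0" if "t \<in> {\<tau> (n - 1)<..<\<tau> n}" for t
      using v(2) that by (simp add: subint_def)
    ultimately have "U t - v t = 0" if "t \<in> {\<tau> (n - 1)..\<tau> n}" for t
      using continuous_constant_on_closure[of "{\<tau> (n - 1)<..<\<tau> n}" "\<lambda>t. U t - v t" 0] that cl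
      by blast
    then show ?thesis
      using v(1) by auto
  qed
  then show ?thesis
    unfolding spline_with_def by metis
qed

text \<open>The weak derivative is the piecewise derivative.  It is written as a sum of indicators of open
  subintervals times polynomials, which makes measurability and boundedness immediate.\<close>

lemma spline_in_trial_space:
  fixes U :: "real \<Rightarrow> 'a::euclidean_space"
  assumes nodes: "\<forall>n\<in>{1..N}. \<tau> (n - 1) < \<tau> n" and N: "0 < N"
    and v: "spline_with N \<tau> r v U"
    and U: "continuous_on {\<tau> 0..\<tau> N} U" "U \<in> extensional {\<tau> 0..\<tau> N}"
  shows "U \<in> trial_space N \<tau> r"
proof -
  note lt = ends_less[OF nodes N]
  have "\<exists>w. \<forall>n\<in>{1..N}. w n \<in> poly_space (int (r n) - 1) UNIV \<and>
          (\<forall>t. (v n has_vector_derivative w n t) (at t))"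
    using v poly_space_derivative unfolding spline_with_def by (intro bchoice) blast
  then obtain w where w: "\<And>n. n \<in> {1..N} \<Longrightarrow> w n \<in> poly_space (int (r n) - 1) UNIV"
      "\<And>n t. n \<in> {1..N} \<Longrightarrow> (v n has_vector_derivative w n t) (at t)"
    by blast
  have cw: "continuous_on S (w n)" if "n \<in> {1..N}" for n S
    using w(1)[OF that] by (rule continuous_on_poly_space)
  define g where "g t = (\<Sum>n=1..N. indicator (subint \<tau> n) t *\<^sub>R w n t)" for t
  have meas: "g \<in> borel_measurable lebesgue"
    unfolding g_def subint_def
    by (intro borel_measurable_sum indicator_continuous_bounded(1) cw)
  have "\<exists>B. \<forall>n\<in>{1..N}. \<forall>t. norm (indicator (subint \<tau> n) t *\<^sub>R w n t) \<le> B n"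
    unfolding subint_def
    by (intro bchoice ballI indicator_continuous_bounded(2) cw)
  then obtain B where "\<And>n t. n \<in> {1..N} \<Longrightarrow> norm (indicator (subint \<tau> n) t *\<^sub>R w n t) \<le> B n"
    by blast
  then have bound: "norm (g t) \<le> (\<Sum>n=1..N. B n)" for t
    unfolding g_def by (intro sum_norm_le)
  have "is_weak_deriv {\<tau> 0<..<\<tau> N} U g"
  proof (rule is_weak_deriv_piecewise[OF lt _ U(1)])
    show "finite (\<tau> ` {..N})" by simp
    show "set_integrable lebesgue {\<tau> 0<..<\<tau> N} g"
      by (rule set_integrable_bounded_Ioo[OF meas bound])
    fix t assume "t \<in> {\<tau> 0<..<\<tau> N} - \<tau> ` {..N}"
    then obtain n where n: "n \<in> {1..N}" "t \<in> subint \<tau> n"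
      using subint_cover by blast
    have "t \<in> subint \<tau> m \<longleftrightarrow> m = n" if "m \<in> {1..N}" for m
      using subint_disjoint[OF nodes that n(1) _ n(2)] n(2) by blast
    then have "g t = (\<Sum>m\<in>{1..N}. if m = n then w n t else 0)"
      unfolding g_def by (intro sum.cong refl) (simp add: indicator_def)
    then have "g t = w n t"
      using n(1) by simp
    moreover have "(U has_vector_derivative w n t) (at t)"
    proof (rule has_vector_derivative_transform_within_open[OF w(2)[OF n(1)]])
      show "open (subint \<tau> n)" "t \<in> subint \<tau> n"
        using n by (auto simp: subint_def)
      show "v n s = U s" if "s \<in> subint \<tau> n" for s
        using v n(1) that by (auto simp: spline_with_def subint_def)
    qed
    ultimately show "(U has_vector_derivative g t) (at t)" by simp
  qed
  moreover have "g \<in> L2_space {\<tau> 0<..<\<tau> N}"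
    by (rule bounded_in_L2_space[OF meas bound])
  ultimately have "U \<in> H1_space {\<tau> 0<..<\<tau> N}"
    using U(1) lt continuous_in_L2_space[OF U(1)] by (auto simp: H1_space_def)
  moreover have "U \<in> poly_space (int (r n)) (subint \<tau> n)" if n: "n \<in> {1..N}" for n
  proof -
    have "v n \<in> poly_space (int (r n)) (subint \<tau> n)"
      by (rule poly_space_subset[of _ _ UNIV]) (use v n in \<open>auto simp: spline_with_def\<close>)
    moreover have "\<And>t. t \<in> subint \<tau> n \<Longrightarrow> U t = v n t"
      using v n by (auto simp: spline_with_def subint_def)
    ultimately show ?thesis
      by (simp add: poly_space_def)
  qed
  ultimately show ?thesis
    using U(2) by (simp add: trial_space_def)
qed

lemma galerkin_eq_spline:
  fixes \<phi> :: "real \<Rightarrow> 'a::euclidean_space"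
  assumes v: "spline_with N \<tau> r v U" and n: "n \<in> {1..N}"
  shows "(LINT t:subint \<tau> n|lebesgue. vector_derivative U (at t) \<bullet> \<phi> t) =
           (LINT t:subint \<tau> n|lebesgue. vector_derivative (v n) (at t) \<bullet> \<phi> t)"
    and "(LINT t:subint \<tau> n|lebesgue. F t (U t) \<bullet> \<phi> t) =
           (LINT t:subint \<tau> n|lebesgue. F t (v n t) \<bullet> \<phi> t)"
proof -
  obtain w where w: "\<And>t. (v n has_vector_derivative w t) (at t)"
    using v n poly_space_derivative unfolding spline_with_def by blast
  have eq: "U t = v n t" if "t \<in> subint \<tau> n" for t
    using v n that by (auto simp: spline_with_def subint_def)
  have "vector_derivative U (at t) = vector_derivative (v n) (at t)" if "t \<in> subint \<tau> n" for t
  proof -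
    have "(U has_vector_derivative w t) (at t)"
      by (rule has_vector_derivative_transform_within_open[OF w _ that])
        (simp_all add: eq subint_def)
    then show ?thesis
      using vector_derivative_at[OF w] by (simp add: vector_derivative_at)
  qed
  then show "(LINT t:subint \<tau> n|lebesgue. vector_derivative U (at t) \<bullet> \<phi> t) =
           (LINT t:subint \<tau> n|lebesgue. vector_derivative (v n) (at t) \<bullet> \<phi> t)"
    by (intro set_lebesgue_integral_cong) (auto simp: subint_def)
  show "(LINT t:subint \<tau> n|lebesgue. F t (U t) \<bullet> \<phi> t) =
           (LINT t:subint \<tau> n|lebesgue. F t (v n t) \<bullet> \<phi> t)"
    by (intro set_lebesgue_integral_cong) (auto simp: subint_def eq[unfolded subint_def])
qed

text \<open>The global equation is the sum of the local ones.  Conversely, the local equation on one subinterval is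
  the global one for a test function that is extended by zero to the other subintervals.\<close>

lemma galerkin_iff_local:
  fixes U :: "real \<Rightarrow> 'a::euclidean_space"
  assumes nodes: "\<forall>n\<in>{1..N}. \<tau> (n - 1) < \<tau> n" and v: "spline_with N \<tau> r v U"
  shows "(\<forall>\<phi>\<in>test_space N \<tau> r.
            (\<Sum>n=1..N. LINT t:subint \<tau> n|lebesgue. vector_derivative U (at t) \<bullet> \<phi> t) =
            (\<Sum>n=1..N. LINT t:subint \<tau> n|lebesgue. F t (U t) \<bullet> \<phi> t)) \<longleftrightarrow>
         (\<forall>n\<in>{1..N}. galerkin_eq F (r n) (subint \<tau> n) (v n))"
    (is "?global \<longleftrightarrow> ?local")
proof
  assume local: ?local
  show ?global
  proof
    fix \<phi> :: "real \<Rightarrow> 'a"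
    assume \<phi>: "\<phi> \<in> test_space N \<tau> r"
    show "(\<Sum>n=1..N. LINT t:subint \<tau> n|lebesgue. vector_derivative U (at t) \<bullet> \<phi> t) =
            (\<Sum>n=1..N. LINT t:subint \<tau> n|lebesgue. F t (U t) \<bullet> \<phi> t)"
    proof (rule sum.cong[OF refl])
      fix n assume n: "n \<in> {1..N}"
      have "\<phi> \<in> poly_space (int (r n) - 1) (subint \<tau> n)"
        using \<phi> n by (simp add: test_space_def)
      then show "(LINT t:subint \<tau> n|lebesgue. vector_derivative U (at t) \<bullet> \<phi> t) =
            (LINT t:subint \<tau> n|lebesgue. F t (U t) \<bullet> \<phi> t)"
        using local n unfolding galerkin_eq_spline[OF v n] galerkin_eq_def by blast
    qed
  qed
next
  assume global: ?global
  show ?local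
  proof
    fix n assume n: "n \<in> {1..N}"
    show "galerkin_eq F (r n) (subint \<tau> n) (v n)"
      unfolding galerkin_eq_def
    proof
      fix \<phi> :: "real \<Rightarrow> 'a"
      assume "\<phi> \<in> poly_space (int (r n) - 1) (subint \<tau> n)"
      then obtain p where p: "p \<in> poly_space (int (r n) - 1) UNIV" "\<forall>t\<in>subint \<tau> n. \<phi> t = p t"
        using poly_space_extension by blast
      define \<eta> where "\<eta> t = indicator (subint \<tau> n) t *\<^sub>R p t" for t
      have on: "\<eta> t = \<phi> t" if "t \<in> subint \<tau> n" for t
        using p(2) that by (simp add: \<eta>_def)
      have off: "\<eta> t = 0" if "t \<in> subint \<tau> m" "m \<in> {1..N}" "m \<noteq> n" for m t
      proof -
        have "t \<notin> subint \<tau> n"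
          using subint_disjoint[OF nodes that(2) n that(1)] that(3) by blast
        then show ?thesis
          by (simp add: \<eta>_def)
      qed
      have "\<eta> \<in> L2_space {\<tau> 0<..<\<tau> N}"
      proof -
        have c: "continuous_on {\<tau> (n - 1)..\<tau> n} p"
          using p(1) by (rule continuous_on_poly_space)
        obtain B where "\<And>t. norm (\<eta> t) \<le> B"
          using indicator_continuous_bounded(2)[OF c] unfolding \<eta>_def subint_def by blast
        moreover have "\<eta> \<in> borel_measurable lebesgue"
          using indicator_continuous_bounded(1)[OF c] unfolding \<eta>_def subint_def .
        ultimately show ?thesis
          by (intro bounded_in_L2_space)
      qed
      moreover have "\<eta> \<in> poly_space (int (r m) - 1) (subint \<tau> m)" if "m \<in> {1..N}" for m
      proof (cases "m = n")
        case True
        have "p \<in> poly_space (int (r n) - 1) (subint \<tau> n)"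
          using p(1) by (rule poly_space_subset) simp
        then show ?thesis
          using True on p(2) by (simp add: poly_space_def)
      next
        case False
        then show ?thesis
          by (intro poly_spaceI[where a = "\<lambda>_. 0"]) (simp add: off[OF _ that False])
      qed
      ultimately have "\<eta> \<in> test_space N \<tau> r"
        by (simp add: test_space_def)
      with global have eq: "(\<Sum>m=1..N. LINT t:subint \<tau> m|lebesgue. vector_derivative U (at t) \<bullet> \<eta> t) =
            (\<Sum>m=1..N. LINT t:subint \<tau> m|lebesgue. F t (U t) \<bullet> \<eta> t)"
        by blast
      have collapse: "(\<Sum>m=1..N. LINT t:subint \<tau> m|lebesgue. f t \<bullet> \<eta> t) =
          (LINT t:subint \<tau> n|lebesgue. f t \<bullet> \<phi> t)" for f
      proof -
        have "(LINT t:subint \<tau> m|lebesgue. f t \<bullet> \<eta> t) =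
            (if m = n then (LINT t:subint \<tau> n|lebesgue. f t \<bullet> \<phi> t) else 0)" if "m \<in> {1..N}" for m
        proof (cases "m = n")
          case True
          then show ?thesis
            by (auto intro!: set_lebesgue_integral_cong simp: on) (simp add: subint_def)
        next
          case False
          then have "(LINT t:subint \<tau> m|lebesgue. f t \<bullet> \<eta> t) = (LINT t:subint \<tau> m|lebesgue. 0)"
            using off that by (intro set_lebesgue_integral_cong) (auto simp: subint_def)
          then show ?thesis
            using False by (simp add: set_lebesgue_integral_def)
        qed
        then show ?thesis
          using n by simp
      qed
      show "(LINT t:subint \<tau> n|lebesgue. vector_derivative (v n) (at t) \<bullet> \<phi> t) =
            (LINT t:subint \<tau> n|lebesgue. F t (v n t) \<bullet> \<phi> t)"
        using eq unfolding collapse galerkin_eq_spline[OF v n] .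
    qed
  qed
qed

theorem theorem1p6:
  fixes T CA CP L :: real and N :: nat and \<tau> :: "nat \<Rightarrow> real" and r :: "nat \<Rightarrow> nat"
    and A :: "real \<Rightarrow> real ^ 'd \<Rightarrow> real ^ 'd ^ 'd"
    and F :: "real \<Rightarrow> real ^ 'd \<Rightarrow> real ^ 'd"
    and u0 :: "real ^ 'd"
  assumes "0 < T"
    and "\<tau> 0 = 0" and "\<tau> N = T" and "\<forall>n\<in>{1..N}. \<tau> (n - 1) < \<tau> n"
    and "0 \<le> CA"
    and "\<forall>v x. \<forall>t\<in>{0..T}. norm (A t v *v x) \<le> CA * norm x"
    and "\<forall>v\<in>piecewise_poly N \<tau>. set_borel_measurable lebesgue {0..T} (\<lambda>t. A t (v t))"
    and "\<forall>v\<in>piecewise_poly N \<tau>. set_integrable lebesgue {0..T} (\<lambda>t. F t (v t))"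
    and "0 < CP"
    and "\<forall>a b. \<forall>w \<in> (H1_space {a<..<b} :: (real \<Rightarrow> real ^ 'd) set). \<forall>w' \<in> L2_space {a<..<b}.
           a < b \<longrightarrow> is_weak_deriv {a<..<b} w w' \<longrightarrow> w a = 0 \<longrightarrow>
           L2_norm {a<..<b} w \<le> (b - a) * CP * L2_norm {a<..<b} w'"
    and "ereal (max_step N \<tau>) < 1 / ereal ((2 * CA + L) * CP)"
    and "\<forall>t\<in>{0..T}. \<forall>v w. norm (F t v - F t w) \<le> L * norm (v - w)"
  shows "\<exists>!U. U \<in> trial_space N \<tau> r \<and> U 0 = u0 \<and>
           (\<forall>\<phi>\<in>test_space N \<tau> r.
              (\<Sum>n=1..N. LINT t:subint \<tau> n|lebesgue. vector_derivative U (at t) \<bullet> \<phi> t) =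
              (\<Sum>n=1..N. LINT t:subint \<tau> n|lebesgue. F t (U t) \<bullet> \<phi> t))"
proof -
  note nodes = assms(4)
  have N: "0 < N"
    using assms(1-3) by (cases N) auto
  (* Two distinct values of the second argument force a Lipschitz constant to be nonnegative. *)
  have L: "0 \<le> L"
  proof -
    have "0 \<le> norm (F 0 1 - F 0 (0 :: real ^ 'd))" by simp
    also have "\<dots> \<le> L * norm (1 - 0 :: real ^ 'd)"
      using assms(1,12) by (metis atLeastAtMost_iff less_imp_le order_refl)
    finally show ?thesis
      by (simp add: zero_le_mult_iff)
  qed
  have step_bound: "L * ((\<tau> n - \<tau> (n - 1)) * CP) < 1" if n: "n \<in> {1..N}" for n
  proof (cases "L = 0")
    case False
    (* Here c is positive, so that the extended real quotient bounding the step is the real 1 / c. *)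
    define c where "c = (2 * CA + L) * CP"
    have c: "0 < c" "L * CP \<le> c"
      using False L assms(5,9) by (auto simp: c_def intro!: mult_right_mono)
    have "\<tau> n - \<tau> (n - 1) \<le> max_step N \<tau>"
      unfolding max_step_def using n by (intro Max_ge) auto
    also have "\<dots> < 1 / c"
      using assms(11) c unfolding c_def[symmetric] by (simp add: one_ereal_def)
    finally have "(\<tau> n - \<tau> (n - 1)) * c < 1"
      using c by (simp add: field_simps)
    moreover have "(\<tau> n - \<tau> (n - 1)) * (L * CP) \<le> (\<tau> n - \<tau> (n - 1)) * c"
      using nodes n c by (intro mult_left_mono) (auto simp: less_imp_le)
    ultimately show ?thesis
      by (simp add: mult_ac)
  qed simp
  have sub: "{\<tau> (n - 1)<..<\<tau> n} \<subseteq> {0..T}" if "n \<in> {1..N}" for n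
  proof -
    have "\<tau> 0 \<le> \<tau> (n - 1)" "\<tau> n \<le> \<tau> N"
      using that by (auto intro!: nodes_mono[OF nodes])
    then show ?thesis
      using assms(2,3) by auto
  qed
  have step: "galerkin_step F (\<tau> (n - 1)) (\<tau> n) L ((\<tau> n - \<tau> (n - 1)) * CP) (r n)"
    if n: "n \<in> {1..N}" for n
  proof
    show lt: "\<tau> (n - 1) < \<tau> n"
      using nodes n by blast
    then show "0 \<le> (\<tau> n - \<tau> (n - 1)) * CP"
      using assms(9) by simp
    show "norm (F t v - F t w) \<le> L * norm (v - w)" if "t \<in> {\<tau> (n - 1)<..<\<tau> n}" for t v w
      using assms(12) sub[OF n] that by blast
    show "set_integrable lebesgue {\<tau> (n - 1)<..<\<tau> n} (\<lambda>t. F t (v t))"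
      if "v \<in> poly_space (int (r n)) UNIV" for v
    proof (rule set_integrable_subset)
      have "v \<in> piecewise_poly N \<tau>"
        unfolding piecewise_poly_def using poly_space_subset[OF that] by blast
      then show "set_integrable lebesgue {0..T} (\<lambda>t. F t (v t))"
        using assms(8) by blast
    qed (use sub[OF n] in auto)
    show "L2_norm {\<tau> (n - 1)<..<\<tau> n} w \<le> (\<tau> n - \<tau> (n - 1)) * CP * L2_norm {\<tau> (n - 1)<..<\<tau> n} w'"
      if w: "w \<in> poly_space (int (r n)) UNIV" and w': "w' \<in> poly_space (int (r n) - 1) UNIV"
        and dw: "\<And>t. (w has_vector_derivative w' t) (at t)" and 0: "w (\<tau> (n - 1)) = 0"
      for w w' :: "real \<Rightarrow> real ^ 'd"
    proof -
      note cw = continuous_on_poly_space[OF w] and cw' = continuous_on_poly_space[OF w']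
      have wd: "is_weak_deriv {\<tau> (n - 1)<..<\<tau> n} w w'"
        by (rule is_weak_deriv_piecewise[OF lt finite.emptyI cw dw set_integrable_Ioo_continuous[OF cw']])
      moreover have "w \<in> H1_space {\<tau> (n - 1)<..<\<tau> n}"
        using wd continuous_in_L2_space[OF cw] continuous_in_L2_space[OF cw'] cw
        unfolding H1_space_def by blast
      ultimately show ?thesis
        using assms(10) continuous_in_L2_space[OF cw'] lt 0 by blast
    qed
  qed (use L step_bound[OF n] in auto)
  show ?thesis
  proof (rule ex_ex1I)
    have "\<exists>v. continuous_on UNIV v \<and> v (\<tau> (n - 1)) = x \<and>
        (v \<in> poly_space (int (r n)) UNIV \<and> galerkin_eq F (r n) (subint \<tau> n) v)"
      if "n \<in> {1..N}" for n x
      using galerkin_step.galerkin_exists[OF step[OF that], of x] continuous_on_poly_space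
      unfolding subint_def by blast
    from glue_pieces[OF nodes this, of u0]
    obtain U v where U: "continuous_on {\<tau> 0..\<tau> N} U" "U (\<tau> 0) = u0"
      and v: "\<forall>n\<in>{1..N}. (v n \<in> poly_space (int (r n)) UNIV \<and> galerkin_eq F (r n) (subint \<tau> n) (v n)) \<and>
                (\<forall>t\<in>{\<tau> (n - 1)..\<tau> n}. U t = v n t)"
      by blast
    define V where "V = restrict U {\<tau> 0..\<tau> N}"
    have VU: "V t = U t" if "t \<in> {\<tau> 0..\<tau> N}" for t
      using that by (simp add: V_def)
    have "V t = v n t" if n: "n \<in> {1..N}" and t: "t \<in> {\<tau> (n - 1)..\<tau> n}" for n t
    proof -
      have "\<tau> 0 \<le> \<tau> (n - 1)" "\<tau> n \<le> \<tau> N"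
        using n by (auto intro!: nodes_mono[OF nodes])
      then show ?thesis
        using VU[of t] v n t by auto
    qed
    then have sv: "spline_with N \<tau> r v V"
      using v by (auto simp: spline_with_def)
    have "continuous_on {\<tau> 0..\<tau> N} V"
      using U(1) by (rule continuous_on_eq) (simp add: VU)
    then have "V \<in> trial_space N \<tau> r"
      by (rule spline_in_trial_space[OF nodes N sv]) (simp add: V_def)
    moreover have "V 0 = u0"
      using U(2) VU[of 0] assms(1-3) by simp
    ultimately show "\<exists>U. U \<in> trial_space N \<tau> r \<and> U 0 = u0 \<and>
           (\<forall>\<phi>\<in>test_space N \<tau> r.
              (\<Sum>n=1..N. LINT t:subint \<tau> n|lebesgue. vector_derivative U (at t) \<bullet> \<phi> t) =
              (\<Sum>n=1..N. LINT t:subint \<tau> n|lebesgue. F t (U t) \<bullet> \<phi> t))"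
      using galerkin_iff_local[OF nodes sv, of F] v by blast
  next
    fix U V
    assume U: "U \<in> trial_space N \<tau> r \<and> U 0 = u0 \<and>
           (\<forall>\<phi>\<in>test_space N \<tau> r.
              (\<Sum>n=1..N. LINT t:subint \<tau> n|lebesgue. vector_derivative U (at t) \<bullet> \<phi> t) =
              (\<Sum>n=1..N. LINT t:subint \<tau> n|lebesgue. F t (U t) \<bullet> \<phi> t))"
      and V: "V \<in> trial_space N \<tau> r \<and> V 0 = u0 \<and>
           (\<forall>\<phi>\<in>test_space N \<tau> r.
              (\<Sum>n=1..N. LINT t:subint \<tau> n|lebesgue. vector_derivative V (at t) \<bullet> \<phi> t) =
              (\<Sum>n=1..N. LINT t:subint \<tau> n|lebesgue. F t (V t) \<bullet> \<phi> t))"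
    obtain u where u: "spline_with N \<tau> r u U"
      using trial_space_pieces[OF nodes N] U by blast
    obtain v where v: "spline_with N \<tau> r v V"
      using trial_space_pieces[OF nodes N] V by blast
    have gu: "\<forall>n\<in>{1..N}. galerkin_eq F (r n) (subint \<tau> n) (u n)"
      using galerkin_iff_local[OF nodes u, of F] U by blast
    have gv: "\<forall>n\<in>{1..N}. galerkin_eq F (r n) (subint \<tau> n) (v n)"
      using galerkin_iff_local[OF nodes v, of F] V by blast
    have "\<forall>t\<in>{\<tau> 0..\<tau> n}. U t = V t" if "n \<le> N" for n
      using that
    proof (induction n)
      case 0
      then show ?case
        using U V assms(2) by simp
    next
      case (Suc n)
      then have n: "Suc n \<in> {1..N}" by simp
      note uS = u[unfolded spline_with_def, rule_format, OF n]
      note vS = v[unfolded spline_with_def, rule_format, OF n]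
      have le: "\<tau> 0 \<le> \<tau> n" "\<tau> n < \<tau> (Suc n)"
        using Suc.prems nodes n by (force intro!: nodes_mono[OF nodes])+
      have init: "u (Suc n) (\<tau> n) = v (Suc n) (\<tau> n)"
        using Suc le uS vS by force
      have "U t = V t" if "t \<in> {\<tau> n..\<tau> (Suc n)}" for t
        using galerkin_step.galerkin_unique[OF step[OF n], of "u (Suc n)" "v (Suc n)" t]
          uS vS gu[rule_format, OF n] gv[rule_format, OF n] init that by (simp add: subint_def)
      then show ?case
        using Suc by force
    qed
    then have "\<And>t. t \<in> {\<tau> 0..\<tau> N} \<Longrightarrow> U t = V t"
      by blast
    moreover have "U \<in> extensional {\<tau> 0..\<tau> N}" "V \<in> extensional {\<tau> 0..\<tau> N}"
      using U V by (auto simp: trial_space_def)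
    ultimately show "U = V"
      by (intro extensionalityI)
  qed
qed

end
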